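(* Let $n\ge 2$, and let $(s_i)_{i\in[0,(k+1)(n+1)[}$ with $s_i\in[0,n[$ be a string that satisfies conditions (N0)–(N5) and (N6') (defined in the context). Then the automaton corresponding to $(s_i)_i$ is an ADFA with $n$ states and an alphabet of $k$ symbols.
   Context: Intervals are intervals of integers: $[a,b]=\{i\in\mathbb{Z}: a\le i\le b\}$, $[a,b[=\{i\in\mathbb{Z}: a\le i<b\}$. Lexicographic order on finite sequences over a totally ordered set: compare at the first differing position; a proper prefix is smaller. An ADFA (trim complete acyclic deterministic finite automaton) is a complete DFA $\mathcal{A}=(S\cup\{\Omega\},\Sigma,\delta,s_0,F)$ with $\Omega\notin S$, $F\subseteq S$, $s_0\neq\Omega$, total transition function $\delta$ (extended to words as usual), such that: $\delta(\Omega,\sigma)=\Omega$ for all $\sigma\in\Sigma$; $\delta(s,x)\ne s$ for all $s\in S$ and all nonempty words $x$; every $s\in S$ is reachable from $s_0$; and from every $s\in S$ some state of $F$ is reachable (by a possibly empty word). Its number of states is $n=|S|$. Automaton corresponding to a string $(s_i)_{i\in[0,(k+1)(n+1)[}$ with $s_i\in[0,n[$: alphabet $[0,k[$ (with its natural order), dead state $\Omega=0$, $S=[1,n]$, initial state $n$, transitions $\delta(i,m)=s_{(k+1)i+m}$ for $i\in[0,n]$, $m\in[0,k[$, and $F=\{i: s_{(k+1)i+k}=1\}$. Write $\Delta(i)=(s_{(k+1)i+m})_{m\in[0,k]}$. The string satisfies (N0)–(N5) and (N6') if there are $d\le n$ and integers $(r_l)_{l\in[0,d]}$ in $[1,n]$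 (the first states of each rank; put $r_{-1}=0$, $r_{d+1}=n+1$, and let $R_l=[r_l,r_{l+1}[$ be the set of states of rank $l$), and positions $(f_i)_{i\in[1,n[}$ (the positions of the first occurrence of each $i\in[1,n[$), each of the form $(k+1)j+m$ with $j\in[0,n]$, $m\in[0,k[$, such that: (N0) $s_0=\cdots=s_k=\cdots=s_{2k}=0$ and $s_{2k+1}=1$; (N1) for all $i\in[0,n]$, $s_{(k+1)i+k}\in\{0,1\}$; (N2) $r_0=1$, $r_1=2$, $r_d=n$, and $r_l<r_{l+1}$ for all $l\in[0,d[$; (N3) for all $i\in[1,n[$: $s_{f_i}=i$, and for all $j\in[0,n]$ and $m\in[0,k[$, if $(k+1)j+m<f_i$ then $s_{(k+1)j+m}\ne i$; (N4) for all $l\in[0,d[$ and all $i\in[r_l,r_{l+1}[$: $kr_{l+1}+1\le f_i$; (N5) for all $l\in[0,d]$ and all $i\in[r_l,r_{l+1}[$ there is $m\in[0,k[$ with $s_{(k+1)i+m}\in[r_{l-1},r_l[$; (N6') for all $l\in[0,d[$ and all $i\in R_l$: $i\prec_{\Psi_c} i+1$. Here $i\prec_{\Psi_c}i'$ means: $\Delta(i)<\Delta(i')$ lexicographically, or $\Delta(i)=\Delta(i')$ and $\Psi_c(i)<\Psi_c(i')$ lexicographically (in the second case it is understood that both characteristic words exist). The characteristic word $\Psi_c(i)$ of $i\in[1,n]$ is defined as follows. The rank of a state $p\in[1,n]$ is the $l$ with $p\in R_l$, and its finality is $s_{(k+1)p+k}$. For each word $\sigma_l\cdots\sigma_0$ over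 $[0,k[$ with $\delta(n,\sigma_l\cdots\sigma_0)=i$, form the sequence $\tau_0\tau_1\cdots\tau_l$, where $\tau_j$ is the triple (rank of $p_j$, $\sigma_j$, finality of $p_j$) and $p_j=\delta(n,\sigma_l\cdots\sigma_{j+1})$ (the empty word gives the empty sequence, for $i=n$). $\Psi_c(i)$ is the lexicographically least such sequence, triples being compared lexicographically.
   Formalization: (N4) is taken as (k+1)r_{l+1} ≤ f_i instead of k r_{l+1}+1 ≤ f_i; with the printed bound the claim fails, e.g. k=2, n=3, string 000 001 120 200 satisfies all conditions but δ(2,1)=2. *)

theory Defs
  imports Main "HOL-Library.List_Lexorder" "HOL-Library.Product_Lexorder"
begin

text \<open>
  List_Lexorder and Product_Lexorder make \<open><\<close> and \<open>\<le>\<close> on lists (proper prefixes are smaller)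
  and on tuples the lexicographic orders.
\<close>

section \<open>Trim complete acyclic deterministic finite automata\<close>

record ('s, 'a) dfa =
  live :: "'s set"
  dead :: "'s"
  alphabet :: "'a set"
  delta :: "'s \<Rightarrow> 'a \<Rightarrow> 's"
  init :: "'s"
  finals :: "'s set"

definition dfa_states :: "('s, 'a) dfa \<Rightarrow> 's set" where
  "dfa_states A = live A \<union> {dead A}"

definition complete_dfa :: "('s, 'a) dfa \<Rightarrow> bool" where
  "complete_dfa A \<longleftrightarrow>
     finite (dfa_states A) \<and> finite (alphabet A) \<and>
     init A \<in> dfa_states A \<and> finals A \<subseteq> dfa_states A \<and>
     (\<forall>q\<in>dfa_states A. \<forall>a\<in>alphabet A. delta A q a \<in> dfa_states A)"

definition run :: "('s, 'a) dfa \<Rightarrow> 's \<Rightarrow> 'a list \<Rightarrow> 's" where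
  "run A q w = foldl (delta A) q w"

definition adfa :: "('s, 'a) dfa \<Rightarrow> bool" where
  "adfa A \<longleftrightarrow>
     complete_dfa A \<and>
     dead A \<notin> live A \<and> finals A \<subseteq> live A \<and> init A \<noteq> dead A \<and>
     (\<forall>a\<in>alphabet A. delta A (dead A) a = dead A) \<and>
     (\<forall>q\<in>live A. \<forall>w\<in>lists (alphabet A). w \<noteq> [] \<longrightarrow> run A q w \<noteq> q) \<and>
     (\<forall>q\<in>live A. \<exists>w\<in>lists (alphabet A). run A (init A) w = q) \<and>
     (\<forall>q\<in>live A. \<exists>w\<in>lists (alphabet A). run A q w \<in> finals A)"

section \<open>The automaton corresponding to a string\<close>

text \<open>
  Throughout, \<open>k\<close> is the size of the alphabet, \<open>n\<close> the number of live states, and the string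
  is a list \<open>s\<close>.
\<close>

definition trans_at :: "nat \<Rightarrow> nat list \<Rightarrow> nat \<Rightarrow> nat \<Rightarrow> nat" where
  "trans_at k s i m = s ! ((k + 1) * i + m)"

definition finality :: "nat \<Rightarrow> nat list \<Rightarrow> nat \<Rightarrow> nat" where
  "finality k s i = s ! ((k + 1) * i + k)"

definition automaton_of :: "nat \<Rightarrow> nat \<Rightarrow> nat list \<Rightarrow> (nat, nat) dfa" where
  "automaton_of n k s =
     \<lparr> live = {1..n}, dead = 0, alphabet = {0..<k}, delta = trans_at k s, init = n,
       finals = {i \<in> {0..n}. finality k s i = 1} \<rparr>"

definition descr :: "nat \<Rightarrow> nat list \<Rightarrow> nat \<Rightarrow> nat list" where
  "descr k s i = map (\<lambda>m. s ! ((k + 1) * i + m)) [0..<k + 1]"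

section \<open>Ranks and characteristic words\<close>

text \<open>
  The first states of the ranks are given by \<open>r :: int \<Rightarrow> nat\<close>, so that \<open>r (- 1)\<close> makes sense;
  only the values on \<open>{- 1..d + 1}\<close> are ever used.
\<close>

definition rank_class :: "(int \<Rightarrow> nat) \<Rightarrow> int \<Rightarrow> nat set" where
  "rank_class r l = {r l..<r (l + 1)}"

definition rank_of :: "int \<Rightarrow> (int \<Rightarrow> nat) \<Rightarrow> nat \<Rightarrow> int" where
  "rank_of d r p = (THE l. l \<in> {0..d} \<and> p \<in> rank_class r l)"

text \<open>
  A word \<open>w\<close> lists \<open>\<sigma>\<^sub>l \<dots> \<sigma>\<^sub>0\<close> from left to right, so \<open>w ! t\<close> is read in the state reached by
  \<open>take t w\<close>, and the triple at position \<open>t\<close> is \<open>\<tau>\<close> with index \<open>l - t\<close>; hence the reversal.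
\<close>

definition word_triples ::
  "nat \<Rightarrow> nat \<Rightarrow> nat list \<Rightarrow> int \<Rightarrow> (int \<Rightarrow> nat) \<Rightarrow> nat list \<Rightarrow> (int \<times> nat \<times> nat) list" where
  "word_triples n k s d r w =
     rev (map (\<lambda>t. let p = run (automaton_of n k s) n (take t w)
                   in (rank_of d r p, w ! t, finality k s p))
              [0..<length w])"

definition triples_to ::
  "nat \<Rightarrow> nat \<Rightarrow> nat list \<Rightarrow> int \<Rightarrow> (int \<Rightarrow> nat) \<Rightarrow> nat \<Rightarrow> (int \<times> nat \<times> nat) list set" where
  "triples_to n k s d r i =
     {word_triples n k s d r w | w.
        w \<in> lists {0..<k} \<and> run (automaton_of n k s) n w = i}"

text \<open>A relation rather than a function, because a least sequence need not exist a priori.\<close>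

definition is_char_word ::
  "nat \<Rightarrow> nat \<Rightarrow> nat list \<Rightarrow> int \<Rightarrow> (int \<Rightarrow> nat) \<Rightarrow> nat \<Rightarrow> (int \<times> nat \<times> nat) list \<Rightarrow> bool" where
  "is_char_word n k s d r i x \<longleftrightarrow>
     x \<in> triples_to n k s d r i \<and> (\<forall>y\<in>triples_to n k s d r i. x \<le> y)"

definition state_prec ::
  "nat \<Rightarrow> nat \<Rightarrow> nat list \<Rightarrow> int \<Rightarrow> (int \<Rightarrow> nat) \<Rightarrow> nat \<Rightarrow> nat \<Rightarrow> bool" where
  "state_prec n k s d r i i' \<longleftrightarrow>
     descr k s i < descr k s i' \<or>
     descr k s i = descr k s i' \<and>
       (\<exists>x x'. is_char_word n k s d r i x \<and> is_char_word n k s d r i' x' \<and> x < x')"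

section \<open>The conditions on strings\<close>

definition is_string :: "nat \<Rightarrow> nat \<Rightarrow> nat list \<Rightarrow> bool" where
  "is_string n k s \<longleftrightarrow> length s = (k + 1) * (n + 1) \<and> set s \<subseteq> {0..<n}"

definition rank_starts :: "nat \<Rightarrow> int \<Rightarrow> (int \<Rightarrow> nat) \<Rightarrow> bool" where
  "rank_starts n d r \<longleftrightarrow>
     0 \<le> d \<and> d \<le> int n \<and> (\<forall>l\<in>{0..d}. r l \<in> {1..n}) \<and> r (- 1) = 0 \<and> r (d + 1) = n + 1"

definition positions :: "nat \<Rightarrow> nat \<Rightarrow> (nat \<Rightarrow> nat) \<Rightarrow> bool" where
  "positions n k f \<longleftrightarrow>
     (\<forall>i\<in>{1..<n}. \<exists>j\<in>{0..n}. \<exists>m\<in>{0..<k}. f i = (k + 1) * j + m)"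

definition cond_N0 :: "nat \<Rightarrow> nat list \<Rightarrow> bool" where
  "cond_N0 k s \<longleftrightarrow> (\<forall>i\<in>{0..2 * k}. s ! i = 0) \<and> s ! (2 * k + 1) = 1"

definition cond_N1 :: "nat \<Rightarrow> nat \<Rightarrow> nat list \<Rightarrow> bool" where
  "cond_N1 n k s \<longleftrightarrow> (\<forall>i\<in>{0..n}. s ! ((k + 1) * i + k) \<in> {0, 1})"

definition cond_N2 :: "nat \<Rightarrow> int \<Rightarrow> (int \<Rightarrow> nat) \<Rightarrow> bool" where
  "cond_N2 n d r \<longleftrightarrow>
     r 0 = 1 \<and> r 1 = 2 \<and> r d = n \<and> (\<forall>l\<in>{0..<d}. r l < r (l + 1))"

definition cond_N3 :: "nat \<Rightarrow> nat \<Rightarrow> nat list \<Rightarrow> (nat \<Rightarrow> nat) \<Rightarrow> bool" where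
  "cond_N3 n k s f \<longleftrightarrow>
     (\<forall>i\<in>{1..<n}. s ! f i = i \<and>
        (\<forall>j\<in>{0..n}. \<forall>m\<in>{0..<k}.
           (k + 1) * j + m < f i \<longrightarrow> s ! ((k + 1) * j + m) \<noteq> i))"

text \<open>
  (N4) says that a state of rank \<open>l\<close> first occurs as the target of a state of rank greater than
  \<open>l\<close>. The description of state \<open>j\<close> begins at position \<open>(k + 1) * j\<close>, so the bound on \<open>f i\<close> is
  \<open>(k + 1) * r (l + 1)\<close>. The source prints \<open>k * r (l + 1) + 1\<close> instead, which does not imply
  acyclicity; see the lemma at the end of this theory.
\<close>

definition cond_N4 :: "nat \<Rightarrow> int \<Rightarrow> (int \<Rightarrow> nat) \<Rightarrow> (nat \<Rightarrow> nat) \<Rightarrow> bool" where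
  "cond_N4 k d r f \<longleftrightarrow>
     (\<forall>l\<in>{0..<d}. \<forall>i\<in>{r l..<r (l + 1)}. (k + 1) * r (l + 1) \<le> f i)"

definition cond_N4_printed :: "nat \<Rightarrow> int \<Rightarrow> (int \<Rightarrow> nat) \<Rightarrow> (nat \<Rightarrow> nat) \<Rightarrow> bool" where
  "cond_N4_printed k d r f \<longleftrightarrow>
     (\<forall>l\<in>{0..<d}. \<forall>i\<in>{r l..<r (l + 1)}. k * r (l + 1) + 1 \<le> f i)"

definition cond_N5 :: "nat \<Rightarrow> nat list \<Rightarrow> int \<Rightarrow> (int \<Rightarrow> nat) \<Rightarrow> bool" where
  "cond_N5 k s d r \<longleftrightarrow>
     (\<forall>l\<in>{0..d}. \<forall>i\<in>{r l..<r (l + 1)}.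
        \<exists>m\<in>{0..<k}. s ! ((k + 1) * i + m) \<in> {r (l - 1)..<r l})"

definition cond_N6' :: "nat \<Rightarrow> nat \<Rightarrow> nat list \<Rightarrow> int \<Rightarrow> (int \<Rightarrow> nat) \<Rightarrow> bool" where
  "cond_N6' n k s d r \<longleftrightarrow>
     (\<forall>l\<in>{0..<d}. \<forall>i\<in>rank_class r l. state_prec n k s d r i (i + 1))"

definition satisfies_N0_N5_N6' :: "nat \<Rightarrow> nat \<Rightarrow> nat list \<Rightarrow> bool" where
  "satisfies_N0_N5_N6' n k s \<longleftrightarrow>
     (\<exists>d r f. rank_starts n d r \<and> positions n k f \<and>
        cond_N0 k s \<and> cond_N1 n k s \<and> cond_N2 n d r \<and> cond_N3 n k s f \<and>
        cond_N4 k d r f \<and> cond_N5 k s d r \<and> cond_N6' n k s d r)"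

text \<open>
  With the printed bound, the string below meets all the conditions, but its state 2 has a loop.
\<close>

lemma cond_N4_printed_not_acyclic:
  "\<exists>n k s d r f. n \<ge> 2 \<and> is_string n k s \<and> rank_starts n d r \<and> positions n k f \<and>
     cond_N0 k s \<and> cond_N1 n k s \<and> cond_N2 n d r \<and> cond_N3 n k s f \<and>
     cond_N4_printed k d r f \<and> cond_N5 k s d r \<and> cond_N6' n k s d r \<and>
     \<not> adfa (automaton_of n k s)"
proof -
  define s :: "nat list" where "s = [0,0,0, 0,0,1, 1,2,0, 2,0,0]"
  define r :: "int \<Rightarrow> nat" where "r = (\<lambda>l. nat (l + 1))"
  define f :: "nat \<Rightarrow> nat" where "f = (\<lambda>i. i + 5)"
  have ivl2: "{0..<2::nat} = {0,1}" "{1..<3::nat} = {1,2}" "{0..3::nat} = {0,1,2,3}"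
    "{0..<2::int} = {0,1}" "{0..2::int} = {0,1,2}" "{0..4::nat} = {0,1,2,3,4}"
    by auto
  have sing: "{i..<Suc i} = {i}" for i :: nat by auto
  have "is_string 3 2 s" by (simp add: is_string_def s_def)
  moreover have "rank_starts 3 2 r" by (auto simp: rank_starts_def r_def)
  moreover have "positions 3 2 f"
    unfolding positions_def ivl2 f_def by simp
  moreover have "cond_N0 2 s" by (simp add: cond_N0_def s_def ivl2)
  moreover have "cond_N1 3 2 s" by (simp add: cond_N1_def s_def ivl2)
  moreover have "cond_N2 3 2 r" by (auto simp: cond_N2_def r_def)
  moreover have "cond_N3 3 2 s f"
    unfolding cond_N3_def ivl2 by (simp add: s_def f_def)
  moreover have "cond_N4_printed 2 2 r f"
    unfolding cond_N4_printed_def ivl2 by (auto simp: r_def f_def)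
  moreover have "cond_N5 2 s 2 r"
    unfolding cond_N5_def ivl2 by (auto simp: r_def s_def)
  moreover have "cond_N6' 3 2 s 2 r"
  proof -
    have "descr 2 s 1 < descr 2 s (1 + 1)" "descr 2 s 2 < descr 2 s (2 + 1)"
      by (simp_all add: descr_def s_def upt_rec)
    moreover have "rank_class r 0 = {1}" "rank_class r 1 = {2}"
      by (auto simp: rank_class_def r_def)
    ultimately show ?thesis
      unfolding cond_N6'_def ivl2 state_prec_def by simp
  qed
  moreover have "\<not> adfa (automaton_of 3 2 s)"
  proof -
    have "run (automaton_of 3 2 s) 2 [1] = 2"
      by (simp add: run_def automaton_of_def trans_at_def s_def)
    moreover have "2 \<in> live (automaton_of 3 2 s)" "[1] \<in> lists (alphabet (automaton_of 3 2 s))"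
      by (simp_all add: automaton_of_def)
    ultimately show ?thesis unfolding adfa_def by blast
  qed
  ultimately show ?thesis
    by (intro exI[of _ 3] exI[of _ 2] exI[of _ s] exI[of _ r] exI[of _ f]) simp
qed

end

(* By (N3) and (N4), every transition into a live state i starts in a state of higher rank, so
   transitions strictly decrease the number of a live state: the automaton is acyclic. The first
   occurrence of i < n gives a transition into i from a larger state, hence a path from n to i;
   (N5) gives a transition from each i \<ge> 2 to a smaller live state, hence a path from i to the
   final state 1. *)
theory Submission
  imports Defs
begin

text \<open>Consecutive intervals leave no gap: a point not yet below \<open>r (int t)\<close> falls
  into the last interval. The upper index is a natural number so that induction applies to integer
  ranks.\<close>

lemma exists_rank:
  fixes r :: "int \<Rightarrow> nat"
  assumes "r 0 \<le> i" "i < r (int t)"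
  shows "\<exists>l\<in>{0..<int t}. i \<in> {r l..<r (l + 1)}"
  using assms
proof (induction t)
  case (Suc t)
  show ?case
  proof (cases "i < r (int t)")
    case True
    then obtain l where "l \<in> {0..<int t}" "i \<in> {r l..<r (l + 1)}"
      using Suc by blast
    then show ?thesis by (intro bexI[of _ l]) auto
  next
    case False
    then show ?thesis
      using Suc.prems by (intro bexI[of _ "int t"]) (auto simp: add.commute)
  qed
qed simp

lemma run_Nil [simp]: "run A q [] = q"
  and run_Cons [simp]: "run A q (a # w) = run A (delta A q a) w"
  and run_append: "run A q (v @ w) = run A (run A q v) w"
  by (simp_all add: run_def)

text \<open>Blocks of different states do not overlap, so comparing string positions reduces to
  comparing states. Offset \<open>k\<close>, the finality entry, still belongs to the block.\<close>

lemma block_index_less: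
  fixes i j m k :: nat
  assumes "i < j" "m \<le> k"
  shows "(k + 1) * i + m < (k + 1) * j"
proof -
  have "(k + 1) * i + m < (k + 1) * (i + 1)" using assms by simp
  also have "\<dots> \<le> (k + 1) * j" using assms by (intro mult_le_mono) auto
  finally show ?thesis .
qed

lemma trans_at_less:
  assumes "is_string n k s" "i \<le> n" "m < k"
  shows "trans_at k s i m < n"
proof -
  have "(k + 1) * i + m < length s"
    using block_index_less[of i "n + 1" m k] assms by (simp add: is_string_def)
  then have "trans_at k s i m \<in> set s"
    unfolding trans_at_def by (rule nth_mem)
  then show ?thesis
    using assms(1) by (auto simp: is_string_def)
qed

text \<open>Since \<open>i < n = r d\<close>, the state has some rank \<open>l < d\<close>, and (N4)
  applies to it; \<open>i < r (l + 1)\<close> then weakens the bound to the start of block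
  \<open>i + 1\<close>.\<close>

lemma first_occurrence_after:
  assumes "rank_starts n d r" "cond_N2 n d r" "cond_N4 k d r f" "i \<in> {1..<n}"
  shows "(k + 1) * (i + 1) \<le> f i"
proof -
  have "r 0 = 1" "r (int (nat d)) = n" "0 \<le> d"
    using assms by (auto simp: rank_starts_def cond_N2_def)
  then obtain l where l: "l \<in> {0..<d}" "i \<in> {r l..<r (l + 1)}"
    using exists_rank[of r i "nat d"] assms(4) by auto
  have "(k + 1) * (i + 1) \<le> (k + 1) * r (l + 1)"
    using l by (intro mult_le_mono) auto
  also have "\<dots> \<le> f i"
    using assms(3) l unfolding cond_N4_def by blast
  finally show ?thesis .
qed

text \<open>A target \<open>q \<ge> p\<close> would occur in block \<open>p\<close>, hence before
  block \<open>q + 1\<close> and so before its own first occurrence \<open>f q\<close>.\<close>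

lemma trans_at_decreasing:
  assumes "is_string n k s" "rank_starts n d r" "cond_N2 n d r" "cond_N3 n k s f"
    "cond_N4 k d r f" and "p \<in> {1..n}" "m < k"
  shows "trans_at k s p m < p"
proof (rule ccontr)
  let ?q = "trans_at k s p m"
  assume "\<not> ?q < p"
  \<comment> \<open>No entry of the string equals \<open>n\<close>, so the target lies in the range
    where \<open>f\<close> is constrained.\<close>
  moreover have "?q < n"
    using trans_at_less assms by simp
  ultimately have q: "?q \<in> {1..<n}" "p < ?q + 1"
    using assms(6) by auto
  have "(k + 1) * p + m < (k + 1) * (?q + 1)"
    using q(2) assms(7) by (intro block_index_less) auto
  also have "\<dots> \<le> f ?q"
    using first_occurrence_after assms q(1) by blast
  finally have "s ! ((k + 1) * p + m) \<noteq> ?q"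
    using assms(4,6,7) q(1) unfolding cond_N3_def by auto
  then show False by (simp add: trans_at_def)
qed

text \<open>The position \<open>f i\<close> itself encodes the transition: its block index
  \<open>j\<close> is the source, which exceeds \<open>i\<close> because \<open>f i\<close> lies
  beyond block \<open>i\<close>.\<close>

lemma exists_larger_predecessor:
  assumes "rank_starts n d r" "positions n k f" "cond_N2 n d r" "cond_N3 n k s f"
    "cond_N4 k d r f" and "i \<in> {1..<n}"
  shows "\<exists>j\<in>{i<..n}. \<exists>m<k. trans_at k s j m = i"
proof -
  obtain j m where jm: "j \<le> n" "m < k" "f i = (k + 1) * j + m"
    using assms(2,6) unfolding positions_def by fastforce
  have "(k + 1) * (i + 1) \<le> (k + 1) * j + m"
    using first_occurrence_after[OF assms(1,3,5,6)] jm(3) by simp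
  then have "\<not> j < i + 1"
    using block_index_less[of j "i + 1" m k] jm(2) by linarith
  moreover have "trans_at k s j m = i"
    using assms(4,6) jm(3) unfolding cond_N3_def trans_at_def by metis
  ultimately show ?thesis
    using jm by (intro bexI[of _ j]) auto
qed

lemma exists_smaller_live_successor:
  assumes "rank_starts n d r" "cond_N2 n d r" "cond_N5 k s d r" and "i \<in> {2..n}"
  shows "\<exists>m<k. trans_at k s i m \<in> {1..<i}"
proof -
  have r: "0 \<le> d" "r 0 = 1" "r 1 = 2" "r (d + 1) = n + 1"
    using assms by (auto simp: rank_starts_def cond_N2_def)
  \<comment> \<open>The initial state \<open>n\<close> is allowed here and has rank
    \<open>d\<close>, so the intervals must extend up to \<open>r (d + 1) = n + 1\<close>.\<close>
  then have "int (nat (d + 1)) = d + 1" by simp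
  then obtain l where l: "l \<in> {0..<d + 1}" "i \<in> {r l..<r (l + 1)}"
    using exists_rank[of r i "nat (d + 1)"] r assms(4) by auto
  \<comment> \<open>Rank 0 is just \<open>{1}\<close>. For it (N5) would yield the dead state, since
    \<open>r (- 1) = 0\<close>; from rank 1 on the target is live.\<close>
  have "l \<noteq> 0" using l(2) r assms(4) by auto
  then have pos: "1 \<le> r (l - 1)"
    using l(1) assms(1) by (auto simp: rank_starts_def)
  have "l \<in> {0..d}" using l(1) by simp
  then obtain m where "m < k" "s ! ((k + 1) * i + m) \<in> {r (l - 1)..<r l}"
    using assms(3) l(2) unfolding cond_N5_def by fastforce
  then show ?thesis
    using pos l(2) by (intro exI[of _ m]) (auto simp: trans_at_def)
qed

theorem theorem3:
  fixes n k :: nat and s :: "nat list"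
  assumes "n \<ge> 2"
    and "is_string n k s"
    and "satisfies_N0_N5_N6' n k s"
  shows "adfa (automaton_of n k s) \<and>
    card (live (automaton_of n k s)) = n \<and> card (alphabet (automaton_of n k s)) = k"
proof -
  obtain d r f where N: "rank_starts n d r" "positions n k f" "cond_N0 k s"
      "cond_N2 n d r" "cond_N3 n k s f" "cond_N4 k d r f" "cond_N5 k s d r"
    using assms(3) unfolding satisfies_N0_N5_N6'_def by blast
  define A where "A = automaton_of n k s"
  have A [simp]: "live A = {1..n}" "dead A = 0" "alphabet A = {0..<k}" "delta A = trans_at k s"
      "init A = n" "finals A = {i \<in> {0..n}. finality k s i = 1}" "dfa_states A = {0..n}"
    by (auto simp: A_def automaton_of_def dfa_states_def)
  have dead: "trans_at k s 0 m = 0" if "m < k" for m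
    using N(3) that by (auto simp: cond_N0_def trans_at_def)
  \<comment> \<open>These are the entries at positions \<open>k\<close> and
    \<open>2 * k + 1\<close>, both fixed by (N0).\<close>
  have fin: "finality k s 0 = 0" "finality k s 1 = 1"
    using N(3) by (auto simp: cond_N0_def finality_def mult_2)
  have dec: "trans_at k s p m < p" if "p \<in> {1..n}" "m < k" for p m
    using trans_at_decreasing assms(2) N that by blast
  \<comment> \<open>The descent is only weak because of the empty word and of runs that stay in the
    dead state 0.\<close>
  have run_le: "run A q w \<le> q" if "q \<le> n" "w \<in> lists {0..<k}" for q w
    using that(2,1)
  proof (induction w arbitrary: q)
    case (Cons a w)
    have "trans_at k s q a \<le> q"
      using dead[of a] dec[of q a] Cons.hyps Cons.prems by (cases "q = 0") auto
    moreover from this have "run A (trans_at k s q a) w \<le> trans_at k s q a"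
      using Cons.prems by (intro Cons.IH) auto
    ultimately show ?case by simp
  qed simp
  have acyclic: "run A q w \<noteq> q" if q: "q \<in> {1..n}" and w: "w \<in> lists {0..<k}" "w \<noteq> []" for q w
  proof -
    obtain a v where v: "w = a # v" "a < k" "v \<in> lists {0..<k}"
      using w by (cases w) auto
    \<comment> \<open>The first letter leads strictly down, and the rest of the word cannot climb
      back.\<close>
    have "trans_at k s q a < q" using dec q v by blast
    moreover have "run A (trans_at k s q a) v \<le> trans_at k s q a"
      using run_le v calculation q by simp
    ultimately show ?thesis using v by simp
  qed
  have reach: "\<exists>w\<in>lists {0..<k}. run A n w = q" if "q \<in> {1..n}" for q
    using that
  \<comment> \<open>The predecessors supplied have larger numbers, so the induction descends from
    \<open>n\<close>.\<close>
  proof (induction "n - q" arbitrary: q rule: less_induct)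
    case less
    show ?case
    proof (cases "q = n")
      case True
      then show ?thesis by (intro bexI[of _ "[]"]) auto
    next
      case False
      then obtain j m where jm: "j \<in> {q<..n}" "m < k" "trans_at k s j m = q"
        using exists_larger_predecessor[OF N(1,2,4-6), of q] less.prems by auto
      moreover from this have "n - j < n - q" "j \<in> {1..n}"
        using less.prems by auto
      ultimately obtain w where "w \<in> lists {0..<k}" "run A n w = j"
        using less.hyps[of j] by blast
      then show ?thesis
        using jm by (intro bexI[of _ "w @ [m]"]) (auto simp: run_append)
    qed
  qed
  have coreach: "\<exists>w\<in>lists {0..<k}. run A q w \<in> finals A" if "q \<in> {1..n}" for q
    using that
  proof (induction q rule: less_induct)
    case (less q)
    show ?case
    proof (cases "q = 1")
      case True
      then show ?thesis using fin less.prems by (intro bexI[of _ "[]"]) auto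
    next
      case False
      then obtain m where m: "m < k" "trans_at k s q m \<in> {1..<q}"
        using exists_smaller_live_successor[OF N(1,4,7), of q] less.prems by auto
      then obtain w where "w \<in> lists {0..<k}" "run A (trans_at k s q m) w \<in> finals A"
        using less.IH[of "trans_at k s q m"] less.prems by auto
      then show ?thesis
        using m by (intro bexI[of _ "m # w"]) auto
    qed
  qed
  have "complete_dfa A"
    using trans_at_less[OF assms(2)] by (auto simp: complete_dfa_def intro: less_imp_le)
  \<comment> \<open>Final states are cut out of \<open>{0..n}\<close>, so only 0 has to be
    excluded.\<close>
  moreover have "finals A \<subseteq> live A"
  proof
    fix q assume "q \<in> finals A"
    with fin(1) show "q \<in> live A" by (cases "q = 0") auto
  qed
  ultimately have "adfa A"
    using assms(1) dead acyclic reach coreach by (simp add: adfa_def)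
  then show ?thesis
    using A(1,3) by (simp add: A_def)
qed

end
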